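(* Let $(X,d)$ be a strictly convex linear metric space. Let $C\subseteq X$ have the property that for every pair of distinct points $x$ and $y$ in $C$ there exists a sequence of points $(z_n)$ in $C$ such that, for each $n$, $z_n=(1+t_n)y-t_nx$ for some $t_n\in(0,1)$, and $z_n\to y$ as $n\to\infty$. Then $d$ is a sleek metric for $C$.
   Context: For a metric space $(Y,d)$, $y\in Y$ and $r>0$, write $B_d(y,r)=\{z\in Y: d(y,z)<r\}$ and $B_d[y,r]=\{z\in Y: d(y,z)\le r\}$. The metric $d$ is a sleek metric for $Y$ if the interior of $B_d[y,r]$ in $Y$ equals $B_d(y,r)$ for all $y\in Y$ and $r>0$; for a subset $C$ of $X$ this refers to the restriction of $d$ to $C$, with balls and interiors taken in $C$. A linear metric space is a topological vector space with a compatible translation invariant metric $d$. A linear metric space $(X,d)$ is strictly convex if for all $r>0$ and all distinct $x,y\in B_d[0,r]$ one has $(x+y)/2\in B_d(0,r)$. *)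

theory Defs
  imports "HOL-Analysis.Analysis"
begin

definition topological_real_vector_space :: "'a::real_vector topology \<Rightarrow> bool" where
  "topological_real_vector_space T \<longleftrightarrow>
     topspace T = UNIV \<and>
     continuous_map (prod_topology T T) T (\<lambda>(x, y). x + y) \<and>
     continuous_map (prod_topology euclideanreal T) T (\<lambda>(c, x). c *\<^sub>R x)"

text \<open>
  The space is the whole type. A complex linear metric space is covered through its underlying
  real vector space, since only real scalars matter below.
\<close>

locale linear_metric_space = Metric_space UNIV d
  for d :: "'a::real_vector \<Rightarrow> 'a \<Rightarrow> real" +
  assumes topological_real_vector_space_mtopology: "topological_real_vector_space mtopology"
    and translation_invariant: "d (x + z) (y + z) = d x y"

locale strictly_convex_linear_metric_space = linear_metric_space +
  assumes strictly_convex: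
    "\<lbrakk>0 < r; x \<in> mcball 0 r; y \<in> mcball 0 r; x \<noteq> y\<rbrakk> \<Longrightarrow> (1/2) *\<^sub>R (x + y) \<in> mball 0 r"

text \<open>
  Balls and interiors are those of the metric space \<open>(Y, d)\<close>; for \<open>Y\<close> a subset of a larger
  space, the values of \<open>d\<close> outside \<open>Y\<close> do not affect them.
\<close>

definition sleek_metric :: "'a set \<Rightarrow> ('a \<Rightarrow> 'a \<Rightarrow> real) \<Rightarrow> bool" where
  "sleek_metric Y d \<longleftrightarrow>
     Metric_space Y d \<and>
     (\<forall>y\<in>Y. \<forall>r>0. Metric_space.mtopology Y d interior_of Metric_space.mcball Y d y r
                   = Metric_space.mball Y d y r)"

end

theory Submission
  imports Defs
begin

text \<open>
  In any metric space the open ball is an open subset of the closed ball with the same centre and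
  radius, so sleekness says that no point \<open>p\<close> of the sphere \<open>d y p = r\<close> is interior to the closed
  ball. The hypothesis on \<open>C\<close> supplies points of \<open>C\<close> arbitrarily close to \<open>p\<close> on the ray from \<open>y\<close>
  through \<open>p\<close>, just beyond \<open>p\<close>. It remains to see that they lie outside the closed ball, that is,
  that the distance from \<open>y\<close> strictly increases along rays (\<open>dist_zero_scaleR_strict_mono\<close>).

  A translation invariant metric need not be homogeneous, so this requires strict convexity. Along
  the segment from \<open>0\<close> to \<open>w \<noteq> 0\<close> the continuous function \<open>f s = d 0 (s *\<^sub>R w)\<close> attains its maximum
  over \<open>[0, 1]\<close>. By strict convexity its value at a midpoint is strictly below the larger of the two
  endpoint values, so the maximum is not attained in \<open>(0, 1)\<close>. Nor is it attained at \<open>0\<close>, where \<open>f\<close>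
  vanishes. Hence it is attained at \<open>1\<close> only.
\<close>

context linear_metric_space
begin

lemma dist_eq_dist_zero_diff: "d x y = d 0 (y - x)"
  using translation_invariant[of 0 x "y - x"] by simp

lemma continuous_on_dist_zero_scaleR: "continuous_on S (\<lambda>s. d 0 (s *\<^sub>R w))"
proof -
  have "continuous_map (prod_topology euclideanreal mtopology) mtopology (\<lambda>(c, x). c *\<^sub>R x)"
    using topological_real_vector_space_mtopology
    unfolding topological_real_vector_space_def by blast
  moreover have "continuous_map euclideanreal (prod_topology euclideanreal mtopology) (\<lambda>s. (s, w))"
    by (intro continuous_map_pairedI continuous_map_id[unfolded id_def]) simp
  ultimately have "continuous_map euclideanreal mtopology ((\<lambda>(c, x). c *\<^sub>R x) \<circ> (\<lambda>s. (s, w)))"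
    by (rule continuous_map_compose[rotated])
  then have "continuous_map euclideanreal mtopology (\<lambda>s. s *\<^sub>R w)"
    by (simp add: o_def)
  then have "continuous_map euclideanreal euclideanreal (\<lambda>s. d 0 (s *\<^sub>R w))"
    using continuous_map_mdist[of euclideanreal Self "\<lambda>s. 0" "\<lambda>s. s *\<^sub>R w"]
    by (simp add: mtopology_of_def)
  then show ?thesis
    using continuous_on_subset by fastforce
qed

end

context strictly_convex_linear_metric_space
begin

text \<open>
  This is strict convexity for the smallest closed ball around \<open>0\<close> that contains both points.
\<close>

lemma dist_zero_midpoint_less_max:
  assumes "x \<noteq> y"
  shows "d 0 ((1/2) *\<^sub>R (x + y)) < max (d 0 x) (d 0 y)"
proof -
  \<comment> \<open>This radius is positive because \<open>x\<close> and \<open>y\<close> are not both \<open>0\<close>.\<close>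
  let ?r = "max (d 0 x) (d 0 y)"
  have "0 < ?r"
    using assms mdist_pos_eq[of 0 x] mdist_pos_eq[of 0 y] by (auto simp: less_max_iff_disj)
  then show ?thesis
    using strictly_convex[of ?r x y] assms by simp
qed

text \<open>
  The maximum over the segment can only be attained at \<open>1\<close>; if the conclusion failed, it would also
  be attained at the interior point \<open>s\<close>. Compactness of \<open>[0, 1]\<close> replaces an approximation of \<open>s\<close> by dyadic
  numbers, which repeated midpoints would call for.
\<close>

lemma dist_zero_scaleR_strict_mono:
  assumes "w \<noteq> 0" "0 < s" "s < 1"
  shows "d 0 (s *\<^sub>R w) < d 0 w"
proof (rule ccontr)
  assume contra: "\<not> d 0 (s *\<^sub>R w) < d 0 w"
  define f where "f = (\<lambda>s. d 0 (s *\<^sub>R w))"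
  have "continuous_on {0..1} f"
    unfolding f_def by (rule continuous_on_dist_zero_scaleR)
  then obtain m where m: "m \<in> {0..1}" "\<And>a. a \<in> {0..1} \<Longrightarrow> f a \<le> f m"
    using continuous_attains_sup[of "{0..1::real}" f] by auto
  have no_interior_max: False
    if c: "0 < c" "c < 1" and max: "\<And>a. a \<in> {0..1} \<Longrightarrow> f a \<le> f c" for c
  proof -
    \<comment> \<open>The largest step for which both \<open>c - h\<close> and \<open>c + h\<close> stay in the unit interval.\<close>
    define h where "h = min c (1 - c)"
    have h: "0 < h" "c - h \<in> {0..1}" "c + h \<in> {0..1}"
      using c by (auto simp: h_def)
    have "(c - h) *\<^sub>R w \<noteq> (c + h) *\<^sub>R w"
      using h assms(1) by simp
    moreover have "(1/2) *\<^sub>R ((c - h) *\<^sub>R w + (c + h) *\<^sub>R w) = c *\<^sub>R w"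
      by (simp flip: scaleR_left_distrib)
    ultimately have "f c < max (f (c - h)) (f (c + h))"
      unfolding f_def using dist_zero_midpoint_less_max by metis
    with max[OF h(2)] max[OF h(3)] show False
      by simp
  qed
  have "f 0 = 0" "0 < f 1"
    using assms(1) by (simp_all add: f_def)
  with m(2)[of 1] have "m \<noteq> 0"
    by auto
  with m no_interior_max[of m] have "m = 1"
    by fastforce
  then have "f a \<le> f s" if "a \<in> {0..1}" for a
    using m(2)[OF that] contra by (simp add: f_def)
  with assms no_interior_max[of s] show False
    by blast
qed

text \<open>
  Moving \<open>x\<close> to \<open>0\<close> turns \<open>y\<close> into the scalar multiple by \<open>1 / (1 + t)\<close> of the point beyond it.
\<close>

lemma dist_less_dist_beyond:
  assumes "x \<noteq> y" "0 < t"
  shows "d x y < d x ((1 + t) *\<^sub>R y - t *\<^sub>R x)"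
proof -
  let ?w = "(1 + t) *\<^sub>R (y - x)"
  have "d 0 ((1 / (1 + t)) *\<^sub>R ?w) < d 0 ?w"
    using assms by (intro dist_zero_scaleR_strict_mono) auto
  moreover have "(1 / (1 + t)) *\<^sub>R ?w = y - x"
    using assms by simp
  moreover have "(1 + t) *\<^sub>R y - t *\<^sub>R x - x = ?w"
    by (simp add: algebra_simps)
  ultimately show ?thesis
    using dist_eq_dist_zero_diff by metis
qed

end

theorem theorem3p7:
  fixes d :: "'a::real_vector \<Rightarrow> 'a \<Rightarrow> real" and C :: "'a set"
  assumes "strictly_convex_linear_metric_space d"
    and "\<And>x y. \<lbrakk>x \<in> C; y \<in> C; x \<noteq> y\<rbrakk> \<Longrightarrow>
      \<exists>z :: nat \<Rightarrow> 'a.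
        (\<forall>n. z n \<in> C \<and> (\<exists>t::real. 0 < t \<and> t < 1 \<and> z n = (1 + t) *\<^sub>R y - t *\<^sub>R x)) \<and>
        limitin (Metric_space.mtopology UNIV d) z y sequentially"
  shows "sleek_metric C d"
proof -
  interpret strictly_convex_linear_metric_space d
    by (rule assms(1))
  interpret C: Metric_space C d
    by (rule subspace) simp
  have "C.mtopology interior_of C.mcball y r = C.mball y r" if y: "y \<in> C" and r: "0 < r" for y r
  proof
    show "C.mball y r \<subseteq> C.mtopology interior_of C.mcball y r"
      using C.mball_subset_mcball C.openin_mball by (rule interior_of_maximal)
    show "C.mtopology interior_of C.mcball y r \<subseteq> C.mball y r"
    proof
      fix p assume p: "p \<in> C.mtopology interior_of C.mcball y r"
      then have "p \<in> C.mcball y r"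
        using interior_of_subset by fastforce
      then have "p \<in> C" "d y p \<le> r"
        by auto
      obtain e where e: "e > 0" "C.mball p e \<subseteq> C.mtopology interior_of C.mcball y r"
        using p openin_interior_of[of C.mtopology "C.mcball y r"]
        unfolding C.openin_mtopology by blast
      have "d y p \<noteq> r"
      proof
        assume sphere: "d y p = r"
        with r have "y \<noteq> p"
          by auto
        then obtain z where
          z: "\<And>n. z n \<in> C \<and> (\<exists>t::real. 0 < t \<and> t < 1 \<and> z n = (1 + t) *\<^sub>R p - t *\<^sub>R y)"
          and lim: "limitin mtopology z p sequentially"
          using assms(2)[OF y \<open>p \<in> C\<close>] by blast
        from lim e(1) have "\<forall>\<^sub>F n in sequentially. d (z n) p < e"
          by (simp add: limitin_metric)
        then obtain n where "d (z n) p < e"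
          using eventually_happens' sequentially_bot by blast
        with z \<open>p \<in> C\<close> have "z n \<in> C.mball p e"
          by (simp add: commute)
        then have "z n \<in> C.mcball y r"
          using e(2) interior_of_subset[of C.mtopology "C.mcball y r"] by blast
        then have "d y (z n) \<le> r"
          by simp
        moreover have "r < d y (z n)"
          using z[of n] dist_less_dist_beyond[OF \<open>y \<noteq> p\<close>] sphere by metis
        ultimately show False
          by simp
      qed
      with y \<open>p \<in> C\<close> \<open>d y p \<le> r\<close> show "p \<in> C.mball y r"
        by simp
    qed
  qed
  then show ?thesis
    unfolding sleek_metric_def using C.Metric_space_axioms by blast
qed

end
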